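(* Let $0 \le a < b < \infty$, let $\alpha \in [0,1]$, $m \in (0,1]$, $s \in (0,1]$, let $k > 1$ be a real number, and let $p, q > 0$ be fixed real numbers. Let $f : [0,\infty) \to \mathbb{R}$ be a function whose restriction to $[a,b]$ is continuous and satisfies $f \in L([a,b])$. If $|f|^{\frac{k}{k-1}}$ belongs to the class $K_{m,1}^{\alpha,s}$ on $[a,b]$, then $$\int_a^b (x-a)^p (b-x)^q f(x)\,dx \le (b-a)^{p+q+1} \left(\beta(\alpha s+1,\, 1)\right)^{\frac{k-1}{k}} \left(\beta(qk+1,\, pk+1)\right)^{\frac{1}{k}} \left[ |f(a)|^{\frac{k}{k-1}} + m\left|f\left(\tfrac{b}{m}\right)\right|^{\frac{k}{k-1}} \right]^{\frac{k-1}{k}}.$$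
   Context: $\beta(x,y) = \int_0^1 t^{x-1}(1-t)^{y-1}\,dt$ (for $x,y>0$) is the Euler Beta function. $L([a,b])$ denotes the Lebesgue integrable functions on $[a,b]$. A function $g : [0,\infty) \to [0,\infty)$ is said to belong to the class $K_{m,1}^{\alpha,s}$ on $[a,b]$ ($s$-$(\alpha,m)$-convex in the first sense) if for all $x, y \in [a,b]$ and all $\mu \in [0,1]$, $$g(\mu x + (1-\mu) y) \le \mu^{\alpha s}\, g(x) + m\,(1-\mu^{\alpha s})\, g\left(\frac{y}{m}\right).$$ *)

theory Defs
  imports "HOL-Analysis.Analysis"
begin

(* Real power with the convention 0^0 = 1; the library has 0 powr 0 = 0. *)
definition rpow :: "real \<Rightarrow> real \<Rightarrow> real" where
  "rpow \<mu> r = (if r = 0 then 1 else \<mu> powr r)"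

(* The class K_{m,1}^{\<alpha>,s} on [a,b]. A function [0,\<infinity>) \<rightarrow> [0,\<infinity>) is represented by a total
   function; only its values on [0,\<infinity>) are constrained. For \<alpha> = 0, \<mu>^{\<alpha> s} is 1 for every
   \<mu> in [0,1], hence rpow. *)
definition class_K1 :: "real \<Rightarrow> real \<Rightarrow> real \<Rightarrow> real \<Rightarrow> real \<Rightarrow> (real \<Rightarrow> real) \<Rightarrow> bool" where
  "class_K1 \<alpha> s m a b g \<longleftrightarrow>
     (\<forall>x\<ge>0. g x \<ge> 0) \<and>
     (\<forall>x\<in>{a..b}. \<forall>y\<in>{a..b}. \<forall>\<mu>\<in>{0..1}.
        g (\<mu> * x + (1 - \<mu>) * y)
          \<le> rpow \<mu> (\<alpha> * s) * g x + m * (1 - rpow \<mu> (\<alpha> * s)) * g (y / m))"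

(* The library defines Beta through Gamma; on positive reals it is Euler's integral. *)
lemma Beta_eq_Euler_integral:
  fixes x y :: real
  assumes "x > 0" and "y > 0"
  shows "Beta x y = (LINT t:{0..1}|lebesgue. t powr (x - 1) * (1 - t) powr (y - 1))"
proof -
  let ?h = "\<lambda>t::real. t powr (x - 1) * (1 - t) powr (y - 1)"
  have I: "(?h has_integral Beta x y) {0..1}"
    using has_integral_Beta_real[OF assms] .
  then have "?h absolutely_integrable_on {0..1}"
    by (intro nonnegative_absolutely_integrable_1) (auto simp: has_integral_integrable)
  then show ?thesis
    using I by (simp add: set_lebesgue_integral_eq_integral(2) integral_unique)
qed

end

theory Submission
  imports Defs
begin

text \<open>
  Put \<open>r = k / (k - 1)\<close>, the exponent conjugate to \<open>k\<close>. The substitution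
  \<open>x = t a + (1 - t) b\<close> turns \<open>x - a\<close> into \<open>(1 - t) (b - a)\<close> and \<open>b - x\<close> into \<open>t (b - a)\<close>, so, with \<open>f\<close>
  replaced by \<open>\<bar>f\<bar>\<close>, the integral is at most \<open>(b - a)\<^bsup>p+q+1\<^esup>\<close> times the integral over \<open>[0,1]\<close> of
  \<open>t\<^bsup>q\<^esup> (1 - t)\<^bsup>p\<^esup> \<bar>f (t a + (1 - t) b)\<bar>\<close>. Hoelder's inequality
  (\<open>Holder_has_integral\<close>) separates the weight from \<open>f\<close>.
  The \<open>k\<close>-th power of the weight integrates to \<open>Beta (q k + 1) (p k + 1)\<close>.

  For the other factor (\<open>class_K1_integral_le\<close>), the class inequality at the endpoints \<open>a\<close> and \<open>b\<close> bounds
  \<open>\<bar>f (t a + (1 - t) b)\<bar>\<^bsup>r\<^esup>\<close> by \<open>t\<^bsup>c\<^esup> A + (1 - t\<^bsup>c\<^esup>) B\<close>, where \<open>c = \<alpha> s\<close>,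
  \<open>A = \<bar>f a\<bar>\<^bsup>r\<^esup>\<close> and \<open>B = m \<bar>f (b / m)\<bar>\<^bsup>r\<^esup>\<close>. This integrates to \<open>(A + c B) / (c + 1)\<close>. Since
  \<open>c \<le> 1\<close>, it is at most \<open>(A + B) / (c + 1)\<close>, and \<open>1 / (c + 1) = Beta (c + 1) 1\<close>.
\<close>

text \<open>
  Scaling \<open>u\<close> and \<open>v\<close> by their norms and integrating Young's inequality gives the bound. The
  norms may vanish, so the scaling uses arbitrary positive upper bounds \<open>U + e\<close>, \<open>V + e\<close>
  of the two integrals, and \<open>e\<close> tends to \<open>0\<close> at the end.
\<close>

lemma Holder_has_integral:
  fixes u v :: "'a::euclidean_space \<Rightarrow> real"
  assumes P: "P > 1" and Q: "Q > 1" and PQ: "1 / P + 1 / Q = 1"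
    and u: "\<And>x. x \<in> S \<Longrightarrow> u x \<ge> 0" and v: "\<And>x. x \<in> S \<Longrightarrow> v x \<ge> 0"
    and U: "((\<lambda>x. u x powr P) has_integral U) S"
    and V: "((\<lambda>x. v x powr Q) has_integral V) S"
    and I: "((\<lambda>x. u x * v x) has_integral I) S"
  shows "I \<le> U powr (1 / P) * V powr (1 / Q)"
proof -
  have U0: "U \<ge> 0" and V0: "V \<ge> 0"
    using has_integral_nonneg[OF U] has_integral_nonneg[OF V] by auto
  have bound: "I \<le> (U + e) powr (1 / P) * (V + e) powr (1 / Q)" if e: "e > 0" for e
  proof -
    define X where "X = (U + e) powr (1 / P)"
    define Y where "Y = (V + e) powr (1 / Q)"
    have pos: "X > 0" "Y > 0" "U + e > 0" "V + e > 0"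
      using U0 V0 e by (auto simp: X_def Y_def)
    have XP: "X powr P = U + e" and YQ: "Y powr Q = V + e"
      using P Q pos by (auto simp: X_def Y_def powr_powr)
    let ?h = "\<lambda>x. X * Y * (u x powr P / (P * (U + e)) + v x powr Q / (Q * (V + e)))"
    have "u x * v x \<le> ?h x" if "x \<in> S" for x
    proof -
      have "(u x / X) * (v x / Y) \<le> (u x / X) powr P / P + (v x / Y) powr Q / Q"
        using u[OF that] v[OF that] pos by (intro Youngs_inequality P Q PQ) simp_all
      also have "\<dots> = u x powr P / (P * (U + e)) + v x powr Q / (Q * (V + e))"
        using u[OF that] v[OF that] pos by (simp add: powr_divide XP YQ mult.commute)
      finally show ?thesis
        using pos by (simp add: divide_simps mult_ac)
    qed
    moreover have "(?h has_integral X * Y * (U / (P * (U + e)) + V / (Q * (V + e)))) S"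
      by (intro has_integral_mult_right has_integral_add has_integral_divide U V)
    ultimately have "I \<le> X * Y * (U / (P * (U + e)) + V / (Q * (V + e)))"
      using has_integral_le[OF I] by blast
    also have "\<dots> \<le> X * Y"
    proof -
      have "U / (P * (U + e)) + V / (Q * (V + e)) \<le> 1 / P + 1 / Q"
        using P Q pos e by (intro add_mono) (simp_all add: pos_divide_le_eq)
      then show ?thesis
        using pos PQ by (simp add: mult_left_le)
    qed
    finally show ?thesis by (simp add: X_def Y_def)
  qed
  have powr_lim: "((\<lambda>e. (W + e) powr y) \<longlongrightarrow> (W + 0) powr y) (at_right 0)"
    if "W \<ge> 0" "y > 0" for W y :: real
  proof (rule tendsto_powr')
    have "eventually (\<lambda>e. 0 \<le> W + e) (at_right 0)"
      using that by (intro eventually_at_rightI[of 0 1]) auto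
    then show "W + 0 \<noteq> 0 \<or> 0 < y \<and> (\<forall>\<^sub>F e in at_right 0. 0 \<le> W + e)"
      using that by blast
  qed (intro tendsto_intros)+
  have "((\<lambda>e. (U + e) powr (1 / P) * (V + e) powr (1 / Q)) \<longlongrightarrow>
          (U + 0) powr (1 / P) * (V + 0) powr (1 / Q)) (at_right 0)"
    using P Q U0 V0 by (intro tendsto_mult powr_lim) auto
  moreover have "eventually (\<lambda>e. I \<le> (U + e) powr (1 / P) * (V + e) powr (1 / Q)) (at_right 0)"
    using bound by (intro eventually_at_rightI[of 0 1]) auto
  ultimately show ?thesis
    using tendsto_lowerbound trivial_limit_at_right_real by fastforce
qed

lemma has_integral_segment_parametrization:
  fixes a b :: real and h :: "real \<Rightarrow> 'b::real_normed_vector"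
  assumes "a < b" and "(h has_integral I) {a..b}"
  shows "((\<lambda>t. h (t * a + (1 - t) * b)) has_integral (1 / (b - a)) *\<^sub>R I) {0..1}"
proof -
  have "((\<lambda>t. h ((a - b) * t + b)) has_integral (1 / (b - a)) *\<^sub>R I)
          ((\<lambda>x. x / (a - b) - b / (a - b)) ` {a..b})"
    using has_integral_affinity[of h I a b "a - b" b] assms by simp
  also have "(\<lambda>x. x / (a - b) - b / (a - b)) ` {a..b} = {0..1}"
  proof -
    have "(\<lambda>x. x / (a - b) - b / (a - b)) ` {a..b} = (\<lambda>x. (1 / (a - b)) * x + (- b / (a - b))) ` {a..b}"
      by (intro image_cong) auto
    also have "\<dots> = {0..1}"
    proof -
      have "(1 / (a - b)) * a + (- b / (a - b)) = 1"
        using assms(1) by (simp add: diff_divide_distrib[symmetric])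
      then show ?thesis
        using assms(1) by (subst image_affinity_atLeastAtMost) auto
    qed
    finally show ?thesis .
  qed
  finally show ?thesis
    by (simp add: algebra_simps)
qed

lemma has_integral_rpow:
  assumes "c \<ge> 0"
  shows "((\<lambda>t. rpow t c) has_integral 1 / (c + 1)) {0..1}"
proof (cases "c = 0")
  case True
  then show ?thesis
    using has_integral_const_real[of "1::real" 0 1] by (simp add: rpow_def)
next
  case False
  then show ?thesis
    using has_integral_powr_from_0[of c 1] assms by (simp add: rpow_def)
qed

lemma Beta_1_right:
  fixes c :: real
  assumes "c > 0"
  shows "Beta c 1 = 1 / c"
proof -
  have "Gamma (c + 1) = c * Gamma c"
    using assms by (intro Gamma_plus1) auto
  then show ?thesis
    using Gamma_real_pos[OF assms] by (simp add: Beta_def)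
qed

text \<open>
  A one-sided Hermite--Hadamard inequality: the class inequality is integrated over the parameter
  of the segment from \<open>b\<close> to \<open>a\<close>. The integral of \<open>1 - t\<^bsup>\<alpha>s\<^esup>\<close> is \<open>\<alpha> s / (\<alpha> s + 1)\<close>, and \<open>\<alpha> s \<le> 1\<close>
  gives the common factor \<open>1 / (\<alpha> s + 1)\<close> for both endpoint terms.
\<close>

lemma class_K1_integral_le:
  assumes K: "class_K1 \<alpha> s m a b g" and ab: "0 \<le> a" "a \<le> b" and m: "m > 0"
    and c: "0 \<le> \<alpha> * s" "\<alpha> * s \<le> 1"
    and V: "((\<lambda>t. g (t * a + (1 - t) * b)) has_integral V) {0..1}"
  shows "V \<le> (g a + m * g (b / m)) / (\<alpha> * s + 1)"
proof -
  let ?c = "\<alpha> * s"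
  have "((\<lambda>t. rpow t ?c * g a + m * (1 - rpow t ?c) * g (b / m)) has_integral
          1 / (?c + 1) * g a + m * (1 - 1 / (?c + 1)) * g (b / m)) {0..1}"
    using has_integral_const_real[of "1::real" 0 1]
    by (intro has_integral_add has_integral_mult_left has_integral_mult_right has_integral_diff
          has_integral_rpow c) simp_all
  moreover have "g (t * a + (1 - t) * b) \<le> rpow t ?c * g a + m * (1 - rpow t ?c) * g (b / m)"
    if "t \<in> {0..1}" for t
    using K ab that by (auto simp: class_K1_def)
  ultimately have "V \<le> 1 / (?c + 1) * g a + m * (1 - 1 / (?c + 1)) * g (b / m)"
    using has_integral_le[OF V] by blast
  also have "1 - 1 / (?c + 1) = ?c / (?c + 1)"
    using c by (simp add: divide_simps)
  also have "1 / (?c + 1) * g a + m * (?c / (?c + 1)) * g (b / m)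
      = (g a + ?c * (m * g (b / m))) / (?c + 1)"
    by (simp add: add_divide_distrib mult_ac)
  also have "\<dots> \<le> (g a + m * g (b / m)) / (?c + 1)"
  proof -
    have "g (b / m) \<ge> 0"
      using K ab m by (simp add: class_K1_def)
    then show ?thesis
      using c m by (intro divide_right_mono add_left_mono mult_left_le_one_le) auto
  qed
  finally show ?thesis .
qed

theorem theorem5:
  fixes a b \<alpha> m s k p q :: real and f :: "real \<Rightarrow> real"
  assumes "0 \<le> a" and "a < b"
    and "\<alpha> \<in> {0..1}" and "m \<in> {0<..1}" and "s \<in> {0<..1}"
    and "k > 1" and "p > 0" and "q > 0"
    and "continuous_on {a..b} f"
    and "set_integrable lebesgue {a..b} f"
    and "class_K1 \<alpha> s m a b (\<lambda>x. \<bar>f x\<bar> powr (k / (k - 1)))"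
  shows "(LINT x:{a..b}|lebesgue. (x - a) powr p * (b - x) powr q * f x)
    \<le> (b - a) powr (p + q + 1)
      * Beta (\<alpha> * s + 1) 1 powr ((k - 1) / k)
      * Beta (q * k + 1) (p * k + 1) powr (1 / k)
      * (\<bar>f a\<bar> powr (k / (k - 1)) + m * \<bar>f (b / m)\<bar> powr (k / (k - 1))) powr ((k - 1) / k)"
proof -
  have [simp]: "k > 0" "k \<noteq> 0" "k \<noteq> 1" "a \<le> b" "b \<noteq> a"
    using assms(2,6) by auto
  note [simp] = assms(2,6-8)
  note cont = assms(9)
  define r where "r = k / (k - 1)"
  define F where "F x = (x - a) powr p * (b - x) powr q * f x" for x
  define w where "w t = t powr q * (1 - t) powr p" for t :: real
  define J where "J = integral {a..b} (\<lambda>x. \<bar>F x\<bar>)"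
  define V where "V = (1 / (b - a)) * integral {a..b} (\<lambda>x. \<bar>f x\<bar> powr r)"
  define C where "C = \<bar>f a\<bar> powr r + m * \<bar>f (b / m)\<bar> powr r"
  have r: "r > 1" "1 / k + 1 / r = 1" "1 / r = (k - 1) / k"
    by (auto simp: r_def divide_simps)
  have c: "0 \<le> \<alpha> * s" "\<alpha> * s \<le> 1"
    using assms(3,5) by (auto intro: mult_le_one)
  have cont_F: "continuous_on {a..b} F"
    unfolding F_def by (intro continuous_intros continuous_on_powr' cont) auto
  have J: "((\<lambda>x. \<bar>F x\<bar>) has_integral J) {a..b}"
    unfolding J_def
    by (intro integrable_integral integrable_continuous_real continuous_intros cont_F)
  have "((\<lambda>x. \<bar>f x\<bar> powr r) has_integral integral {a..b} (\<lambda>x. \<bar>f x\<bar> powr r)) {a..b}"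
    using r by (intro integrable_integral integrable_continuous_real continuous_intros
        continuous_on_powr' cont) auto
  from has_integral_segment_parametrization[OF assms(2) this]
  have V: "((\<lambda>t. \<bar>f (t * a + (1 - t) * b)\<bar> powr r) has_integral V) {0..1}"
    by (simp add: V_def)
  have V_le: "V \<le> Beta (\<alpha> * s + 1) 1 * C"
    using class_K1_integral_le[OF assms(11) _ _ _ c V[unfolded r_def]] assms(1,4) c
    by (simp add: Beta_1_right C_def r_def)
  have F_segment: "\<bar>F (t * a + (1 - t) * b)\<bar> =
      (b - a) powr (p + q) * (w t * \<bar>f (t * a + (1 - t) * b)\<bar>)" if "t \<in> {0..1}" for t
  proof -
    have "t * a + (1 - t) * b - a = (1 - t) * (b - a)" "b - (t * a + (1 - t) * b) = t * (b - a)"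
      by (auto simp: algebra_simps)
    then show ?thesis
      using that by (simp add: F_def w_def abs_mult powr_mult powr_add mult_ac)
  qed
  have "((\<lambda>t. (b - a) powr (p + q) * (w t * \<bar>f (t * a + (1 - t) * b)\<bar>)) has_integral J / (b - a)) {0..1}"
    using has_integral_segment_parametrization[OF assms(2) J] F_segment
    by (subst has_integral_cong[OF F_segment[symmetric]]) auto
  from has_integral_divide[OF this, of "(b - a) powr (p + q)"]
  have wf: "((\<lambda>t. w t * \<bar>f (t * a + (1 - t) * b)\<bar>) has_integral J / (b - a) / (b - a) powr (p + q)) {0..1}"
    by simp
  have "w t powr k = t powr (q * k + 1 - 1) * (1 - t) powr (p * k + 1 - 1)" if "t \<in> {0..1}" for t
    using that by (simp add: w_def powr_mult powr_powr)
  moreover have "((\<lambda>t. t powr (q * k + 1 - 1) * (1 - t) powr (p * k + 1 - 1)) has_integral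
      Beta (q * k + 1) (p * k + 1)) {0..1}"
    by (rule has_integral_Beta_real) (auto intro!: add_pos_pos)
  ultimately have W: "((\<lambda>t. w t powr k) has_integral Beta (q * k + 1) (p * k + 1)) {0..1}"
    by (subst has_integral_cong) auto
  have "V powr (1 / r) \<le> (Beta (\<alpha> * s + 1) 1 * C) powr (1 / r)"
    using V_le r(1) has_integral_nonneg[OF V] by (intro powr_mono2) auto
  also have "\<dots> = Beta (\<alpha> * s + 1) 1 powr ((k - 1) / k) * C powr ((k - 1) / k)"
    by (simp only: r(3) powr_mult)
  finally have V_powr: "V powr (1 / r) \<le> Beta (\<alpha> * s + 1) 1 powr ((k - 1) / k) * C powr ((k - 1) / k)" .
  have "J / (b - a) / (b - a) powr (p + q) \<le> Beta (q * k + 1) (p * k + 1) powr (1 / k) * V powr (1 / r)"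
    using Holder_has_integral[OF _ r(1,2) _ _ W V wf] by (simp add: w_def)
  also have "\<dots> \<le> Beta (q * k + 1) (p * k + 1) powr (1 / k)
      * (Beta (\<alpha> * s + 1) 1 powr ((k - 1) / k) * C powr ((k - 1) / k))"
    by (intro mult_left_mono V_powr) simp
  finally have J_le: "J \<le> (b - a) powr (p + q + 1) * (Beta (q * k + 1) (p * k + 1) powr (1 / k)
      * (Beta (\<alpha> * s + 1) 1 powr ((k - 1) / k) * C powr ((k - 1) / k)))"
    by (simp add: powr_add pos_divide_le_eq mult_ac)
  have "F absolutely_integrable_on {a..b}"
    using cont_F by (simp add: absolutely_integrable_continuous_real)
  then have "(LINT x:{a..b}|lebesgue. F x) = integral {a..b} F"
    by (rule set_lebesgue_integral_eq_integral)
  also have "\<dots> \<le> J"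
    unfolding J_def
    by (intro integral_le integrable_continuous_real continuous_intros cont_F) auto
  also note J_le
  finally show ?thesis
    by (simp add: F_def C_def r_def mult_ac)
qed

end
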